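(* Let $1\le k\le M$ and $x>0$. Let $i^*$ be the index of the device with the $k$-th largest harvested energy among $E_1,\dots,E_M$ (energy-based selection, EBS) and $\Pi^{(k)}_{\rm EBS}(x)=\mathbb P\{X_{i^*}\le x\}$. With all other parameters fixed, $$\Pi^\infty_{\rm EBS}(x):=\lim_{P_t\to\infty}\Pi^{(k)}_{\rm EBS}(x)=1-\exp\left(-\frac{\sigma_n^2ct_2x}{t_1(ac-b)}\right).$$
   Context: There are $M\ge 1$ devices. The channel gains $|g_1|^2,\dots,|g_M|^2,|h_1|^2,\dots,|h_M|^2$ are independent exponential random variables with mean $1$. Parameters: $P_t>0$, $\sigma_n^2>0$, $0<t_1<1$, $t_2=1-t_1$, and real constants $a,b,c$ with $c>0$ and $ac-b>0$. The energy harvested by device $i$ is $E_i=t_1\left(\frac{aP_t|g_i|^2+b}{P_t|g_i|^2+c}-\frac bc\right)$, and the SNR of device $i$ is $X_i=\frac{|h_i|^2}{t_2\sigma_n^2}E_i$. *)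

theory Defs
  imports "HOL-Probability.Probability"
begin

text \<open>Throughout, \<open>G i\<close> and \<open>H i\<close> are the power gains \<open>|g_i|^2\<close> and \<open>|h_i|^2\<close> of device \<open>i\<close>,
  and the devices are \<open>1, ..., M\<close>.\<close>

definition harvested_energy :: "real \<Rightarrow> real \<Rightarrow> real \<Rightarrow> real \<Rightarrow> real \<Rightarrow> real \<Rightarrow> real" where
  "harvested_energy t1 a b c Pt gain = t1 * ((a * Pt * gain + b) / (Pt * gain + c) - b / c)"

text \<open>The argument \<open>noise\<close> is the noise power \<open>\<sigma>_n^2\<close>.\<close>

definition snr :: "real \<Rightarrow> real \<Rightarrow> real \<Rightarrow> real \<Rightarrow> real" where
  "snr t2 noise gain E = gain / (t2 * noise) * E"

text \<open>Sorting is stable, so ties (which have probability zero for the harvested energies) go to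
  the smaller index. Meaningful for \<open>1 \<le> k \<le> M\<close>.\<close>

definition kth_largest_index :: "nat \<Rightarrow> nat \<Rightarrow> (nat \<Rightarrow> real) \<Rightarrow> nat" where
  "kth_largest_index M k v = sort_key (\<lambda>i. - v i) [1..<Suc M] ! (k - 1)"

definition outage_EBS ::
  "'w measure \<Rightarrow> (nat \<Rightarrow> 'w \<Rightarrow> real) \<Rightarrow> (nat \<Rightarrow> 'w \<Rightarrow> real) \<Rightarrow> nat \<Rightarrow> nat \<Rightarrow>
    real \<Rightarrow> real \<Rightarrow> real \<Rightarrow> real \<Rightarrow> real \<Rightarrow> real \<Rightarrow> real \<Rightarrow> real \<Rightarrow> real" where
  "outage_EBS \<Omega> G H M k t1 t2 noise a b c Pt x =
    measure \<Omega> {\<omega> \<in> space \<Omega>.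
      let E = (\<lambda>i. harvested_energy t1 a b c Pt (G i \<omega>));
          i = kth_largest_index M k E
      in snr t2 noise (H i \<omega>) (E i) \<le> x}"

end

(* The harvested energy is strictly increasing in the gain, so the index N selected by EBS is that
   of the k-th largest gain G i: it does not depend on Pt and is independent of the gains H i.
   Hence H at index N is again exponential with mean 1. As Pt tends to infinity, every harvested
   energy tends to t1 * (a - b / c), so the SNR of the selected device converges almost surely to a
   multiple of an exponential variable; its distribution is atomless, so the probabilities converge. *)

theory Submission
  imports Defs
begin

section \<open>Order invariance and range of the selected index\<close>

lemma insort_key_order_cong:
  assumes "\<And>j. j \<in> set ys \<Longrightarrow> f i \<le> f j \<longleftrightarrow> g i \<le> g j"
  shows "insort_key f i ys = insort_key g i ys"
  using assms by (induction ys) auto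

lemma sort_key_order_cong:
  assumes "\<And>i j. i \<in> set xs \<Longrightarrow> j \<in> set xs \<Longrightarrow> f i \<le> f j \<longleftrightarrow> g i \<le> g j"
  shows "sort_key f xs = sort_key g xs"
  using assms
proof (induction xs)
  case (Cons i xs)
  then have "sort_key f xs = sort_key g xs" by simp
  moreover have "insort_key f i (sort_key g xs) = insort_key g i (sort_key g xs)"
    using Cons.prems by (intro insort_key_order_cong) simp
  ultimately show ?case by simp
qed simp

text \<open>Sorting sees its keys only through comparisons of devices in \<open>{1..M}\<close>. This
  lets energies be traded for gains, which removes the power, and makes values outside
  \<open>{1..M}\<close> irrelevant.\<close>

lemma kth_largest_index_order_cong:
  assumes "\<And>i j. i \<in> {1..M} \<Longrightarrow> j \<in> {1..M} \<Longrightarrow> u i \<le> u j \<longleftrightarrow> v i \<le> v j"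
  shows "kth_largest_index M k u = kth_largest_index M k v"
proof -
  have "sort_key (\<lambda>i. - u i) [1..<Suc M] = sort_key (\<lambda>i. - v i) [1..<Suc M]"
    using assms by (intro sort_key_order_cong) auto
  then show ?thesis by (simp only: kth_largest_index_def)
qed

lemma kth_largest_index_in_range:
  assumes "1 \<le> k" "k \<le> M"
  shows "kth_largest_index M k v \<in> {1..M}"
proof -
  have "kth_largest_index M k v \<in> set (sort_key (\<lambda>i. - v i) [1..<Suc M])"
    unfolding kth_largest_index_def using assms by (intro nth_mem) (simp del: upt_Suc)
  then show ?thesis by (simp del: upt_Suc add: atLeastLessThanSuc_atLeastAtMost)
qed

section \<open>Measurability of the selected index\<close>

text \<open>Insertion is a finite cascade of case distinctions, each on a measurable event of the
  form \<open>f i w \<le> f j w\<close>.\<close>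

lemma measurable_insort_key:
  fixes f :: "'a \<Rightarrow> 'w \<Rightarrow> real"
  assumes "f i \<in> borel_measurable M" "\<And>j. j \<in> set ys \<Longrightarrow> f j \<in> borel_measurable M"
  shows "(\<lambda>w. insort_key (\<lambda>j. f j w) i ys) \<in> measurable M (count_space UNIV)"
  using assms(2)
proof (induction ys)
  case (Cons j ys)
  have f: "f i \<in> borel_measurable M" "f j \<in> borel_measurable M"
    using assms(1) Cons.prems by auto
  have "(\<lambda>w. insort_key (\<lambda>j. f j w) i ys) \<in> measurable M (count_space UNIV)"
    using Cons by simp
  then have "(\<lambda>w. j # insort_key (\<lambda>j. f j w) i ys) \<in> measurable M (count_space UNIV)"
    by (rule measurable_compose) simp
  then show ?case
    unfolding insort_key.simps by (intro measurable_If borel_measurable_le f) auto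
qed simp

text \<open>The list receiving the new element is itself random, but it takes only countably many
  values, so the insertion can be treated separately for each fixed list.\<close>

lemma measurable_sort_key:
  fixes f :: "'a :: countable \<Rightarrow> 'w \<Rightarrow> real"
  assumes "\<And>j. j \<in> set xs \<Longrightarrow> f j \<in> borel_measurable M"
  shows "(\<lambda>w. sort_key (\<lambda>j. f j w) xs) \<in> measurable M (count_space UNIV)"
  using assms
proof (induction xs)
  case (Cons i xs)
  \<comment> \<open>The codomain is cut down to lists with the elements of \<open>xs\<close>,
    because \<open>f j\<close> is known to be measurable only for those \<open>j\<close>.\<close>
  have sort: "(\<lambda>w. sort_key (\<lambda>j. f j w) xs) \<in> measurable M (count_space {ys. set ys = set xs})"
  proof (rule measurable_count_space_extend[OF subset_UNIV])
    show "(\<lambda>w. sort_key (\<lambda>j. f j w) xs) \<in> measurable M (count_space UNIV)"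
      by (rule Cons.IH) (simp add: Cons.prems)
  qed simp
  have "(\<lambda>w. insort_key (\<lambda>j. f j w) i ys) \<in> measurable M (count_space UNIV)"
    if "ys \<in> {ys. set ys = set xs}" for ys
    by (rule measurable_insort_key) (use that Cons.prems in simp_all)
  then have "(\<lambda>w. insort_key (\<lambda>j. f j w) i (sort_key (\<lambda>j. f j w) xs)) \<in> measurable M (count_space UNIV)"
    by (rule measurable_compose_countable'[OF _ sort]) (assumption, rule countableI_type)
  then show ?case by simp
qed simp

lemma measurable_kth_largest_index:
  assumes "\<And>i. i \<in> {1..M} \<Longrightarrow> f i \<in> borel_measurable N"
  shows "(\<lambda>w. kth_largest_index M k (\<lambda>i. f i w)) \<in> measurable N (count_space UNIV)"
proof -
  have "(\<lambda>w. sort_key (\<lambda>j. - f j w) [1..<Suc M]) \<in> measurable N (count_space UNIV)"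
    by (rule measurable_sort_key) (use assms in auto)
  then show ?thesis unfolding kth_largest_index_def
    by (rule measurable_compose) simp
qed

section \<open>Monotonicity and saturation of the harvested energy\<close>

text \<open>Over a common denominator, the difference of two energies is a positive factor times the
  difference of the gains; \<open>a * c - b > 0\<close> fixes the sign.\<close>

lemma harvested_energy_le_iff:
  assumes "0 < t1" "0 < c" "0 < a * c - b" "0 < Pt" "0 \<le> g" "0 \<le> g'"
  shows "harvested_energy t1 a b c Pt g \<le> harvested_energy t1 a b c Pt g' \<longleftrightarrow> g \<le> g'"
proof -
  have pos: "0 < Pt * g + c" "0 < Pt * g' + c"
    using assms by (simp_all add: add_nonneg_pos)
  have "harvested_energy t1 a b c Pt g' - harvested_energy t1 a b c Pt g
      = t1 * (a * c - b) * Pt / ((Pt * g + c) * (Pt * g' + c)) * (g' - g)"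
    using pos unfolding harvested_energy_def by (simp add: field_simps)
  moreover have "0 < t1 * (a * c - b) * Pt / ((Pt * g + c) * (Pt * g' + c))"
    using assms pos by simp
  ultimately have "0 \<le> harvested_energy t1 a b c Pt g' - harvested_energy t1 a b c Pt g
      \<longleftrightarrow> 0 \<le> g' - g"
    by (simp only: zero_le_mult_iff) linarith
  then show ?thesis by simp
qed

text \<open>Splitting off the constant \<open>a\<close> leaves a fraction whose denominator grows
  with the power. Positivity of \<open>g\<close> matters: for \<open>g = 0\<close> the energy is 0
  at every power.\<close>

lemma harvested_energy_tendsto:
  assumes "0 < g"
  shows "((\<lambda>Pt. harvested_energy t1 a b c Pt g) \<longlongrightarrow> t1 * (a - b / c)) at_top"
proof -
  have lim: "((\<lambda>P::real. d / (P * g + c)) \<longlongrightarrow> 0) at_top" for d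
    using assms by real_asymp
  have "\<forall>\<^sub>F P in at_top. 0 < P * g + c"
    using assms by real_asymp
  then have "\<forall>\<^sub>F P in at_top. t1 * (a + (b - a * c) / (P * g + c) - b / c) = harvested_energy t1 a b c P g"
    by eventually_elim (simp add: harvested_energy_def field_simps)
  moreover have "((\<lambda>P. t1 * (a + (b - a * c) / (P * g + c) - b / c)) \<longlongrightarrow> t1 * (a + 0 - b / c)) at_top"
    by (intro tendsto_intros lim)
  ultimately show ?thesis
    by (auto elim: Lim_transform_eventually[rotated])
qed

section \<open>Probabilistic tools: null events, random selection, convergence\<close>

lemma distributed_lborel_AE_neq:
  fixes X :: "'a \<Rightarrow> real"
  assumes "distributed M lborel X f"
  shows "AE \<omega> in M. X \<omega> \<noteq> y"
proof -
  have "AE z in density lborel f. z \<noteq> y"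
    using distributed_borel_measurable[OF assms] AE_lborel_singleton[of y]
    by (subst AE_density) auto
  then have "AE z in distr M lborel X. z \<noteq> y"
    by (subst distributed_distr_eq_density[OF assms])
  then show ?thesis
    by (rule AE_distrD[OF distributed_measurable[OF assms]])
qed

lemma (in prob_space) exponential_AE_pos:
  assumes "distributed M lborel X (exponential_density l)" "0 < l"
  shows "AE \<omega> in M. 0 < X \<omega>"
proof -
  have [measurable]: "X \<in> borel_measurable M"
    using distributed_measurable[OF assms(1)] by simp
  have "\<P>(\<omega> in M. X \<omega> \<le> 0) = 0"
    using exponential_distributedD_le[OF assms(1) order_refl assms(2)] by simp
  then have "AE \<omega> in M. \<not> X \<omega> \<le> 0"
    by (subst (asm) prob_Collect_eq_0) auto
  then show ?thesis by (simp add: not_le)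
qed

text \<open>Total probability over the value of \<open>N\<close>: each event
  \<open>N \<omega> = i\<close> contributes its own probability times the common value
  \<open>p\<close>, and these weights sum to 1.\<close>

lemma (in prob_space) prob_independent_selection:
  assumes N: "N \<in> measurable M (count_space I)" and I: "finite I"
    and ev: "\<And>i. i \<in> I \<Longrightarrow> Measurable.pred M (Q i)"
    and ind: "\<And>i. i \<in> I \<Longrightarrow>
      \<P>(\<omega> in M. N \<omega> = i \<and> Q i \<omega>) = \<P>(\<omega> in M. N \<omega> = i) * \<P>(\<omega> in M. Q i \<omega>)"
    and p: "\<And>i. i \<in> I \<Longrightarrow> \<P>(\<omega> in M. Q i \<omega>) = p"
  shows "\<P>(\<omega> in M. Q (N \<omega>) \<omega>) = p"
proof -
  have N_eq: "Measurable.pred M (\<lambda>\<omega>. N \<omega> = i)" if "i \<in> I" for i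
    using N that by (simp add: pred_def measurable_count_space_eq2[OF I] vimage_def Int_def conj_commute)
  have Q_N: "Measurable.pred M (\<lambda>\<omega>. Q (N \<omega>) \<omega>)"
    using measurable_compose_countable'[OF ev N countable_finite[OF I]] .
  have N_in: "N \<omega> \<in> I" if "\<omega> \<in> space M" for \<omega>
    using measurable_space[OF N that] by simp
  have "\<P>(\<omega> in M. Q (N \<omega>) \<omega>) = (\<Sum>i\<in>I. \<P>(\<omega> in M. N \<omega> = i \<and> Q i \<omega>))"
    by (rule prob_sum) (use I N_in N_eq ev Q_N in auto)
  also have "\<dots> = (\<Sum>i\<in>I. \<P>(\<omega> in M. N \<omega> = i)) * p"
    by (simp add: ind p sum_distrib_right)
  \<comment> \<open>The same partition by the values of \<open>N\<close>, now applied to the sure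
    event.\<close>
  also have "(\<Sum>i\<in>I. \<P>(\<omega> in M. N \<omega> = i)) = \<P>(\<omega> in M. True)"
    by (rule prob_sum[symmetric]) (use I N_in N_eq in auto)
  finally show ?thesis by (simp add: prob_space)
qed

text \<open>The indicator of \<open>{..x}\<close> is continuous away from \<open>x\<close>, a value
  that \<open>Y\<close> almost surely avoids. So the indicators converge almost surely, and
  dominated convergence with bound 1 carries this over to the probabilities.\<close>

lemma (in prob_space) prob_tendsto_at_top:
  fixes X :: "real \<Rightarrow> 'a \<Rightarrow> real"
  assumes meas: "\<And>t. X t \<in> borel_measurable M" "Y \<in> borel_measurable M"
    and lim: "AE \<omega> in M. ((\<lambda>t. X t \<omega>) \<longlongrightarrow> Y \<omega>) at_top"
    and neq: "AE \<omega> in M. Y \<omega> \<noteq> x"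
  shows "((\<lambda>t. \<P>(\<omega> in M. X t \<omega> \<le> x)) \<longlongrightarrow> \<P>(\<omega> in M. Y \<omega> \<le> x)) at_top"
proof -
  note [measurable] = meas
  have eq: "\<P>(\<omega> in M. Z \<omega> \<le> x) = (\<integral>\<omega>. indicator {..x} (Z \<omega>) \<partial>M)"
    if [measurable]: "Z \<in> borel_measurable M" for Z :: "'a \<Rightarrow> real"
  proof -
    have "(\<integral>\<omega>. indicator {..x} (Z \<omega>) \<partial>M) = (\<integral>\<omega>. indicator {\<omega> \<in> space M. Z \<omega> \<le> x} \<omega> \<partial>M :: real)"
      by (rule Bochner_Integration.integral_cong) (auto simp: indicator_def)
    then show ?thesis by simp
  qed
  have "AE \<omega> in M. ((\<lambda>t. indicator {..x} (X t \<omega>) :: real) \<longlongrightarrow> indicator {..x} (Y \<omega>)) at_top"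
    using lim neq
  proof eventually_elim
    case (elim \<omega>)
    \<comment> \<open>On either side of \<open>x\<close> the indicator is locally constant, so it
      eventually equals its limit.\<close>
    have "\<forall>\<^sub>F t in at_top. indicator {..x} (X t \<omega>) = (indicator {..x} (Y \<omega>) :: real)"
    proof (cases "Y \<omega> < x")
      case True
      show ?thesis
        using order_tendstoD(2)[OF elim(1) True] by eventually_elim (use True in simp)
    next
      case False
      with elim(2) have "x < Y \<omega>" by simp
      from order_tendstoD(1)[OF elim(1) this] show ?thesis
        by eventually_elim (use \<open>x < Y \<omega>\<close> in simp)
    qed
    then show ?case by (rule tendsto_eventually)
  qed
  then have "((\<lambda>t. \<integral>\<omega>. (indicator {..x} (X t \<omega>) :: real) \<partial>M) \<longlongrightarrow> (\<integral>\<omega>. indicator {..x} (Y \<omega>) \<partial>M)) at_top"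
    by (intro integral_dominated_convergence_at_top[where w = "\<lambda>_. 1"]) (auto simp: indicator_def)
  then show ?thesis by (simp add: eq meas)
qed

section \<open>Independence of the selected index from the gains \<open>H i\<close>\<close>

text \<open>The index is a measurable function of the \<open>Inl\<close> coordinates, while
  \<open>H i\<close> is the single coordinate \<open>Inr i\<close>; disjoint blocks of an
  independent family are independent.\<close>

lemma (in prob_space) indep_kth_largest_index:
  assumes ind: "indep_vars (\<lambda>_. borel) (case_sum G H) ({1..m} <+> {1..m})"
    and i: "i \<in> {1..m}" and A: "A \<in> sets borel"
  shows "\<P>(\<omega> in M. kth_largest_index m k (\<lambda>j. G j \<omega>) = i \<and> (H i \<omega> :: real) \<in> A) =
    \<P>(\<omega> in M. kth_largest_index m k (\<lambda>j. G j \<omega>) = i) * \<P>(\<omega> in M. H i \<omega> \<in> A)"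
proof -
  let ?K = "\<lambda>g :: nat + nat \<Rightarrow> real. kth_largest_index m k (\<lambda>j. g (Inl j))"
  let ?A = "Inl ` {1..m} :: (nat + nat) set" and ?B = "{Inr i} :: (nat + nat) set"
  let ?PA = "PiM ?A (\<lambda>_. borel :: real measure)" and ?PB = "PiM ?B (\<lambda>_. borel :: real measure)"
  have "?K \<in> measurable ?PA (count_space UNIV)"
    by (intro measurable_kth_largest_index measurable_component_singleton) auto
  then have KA: "?K -` {i} \<inter> space ?PA \<in> sets ?PA"
    by (rule measurable_sets) simp
  have HB: "(\<lambda>g. g (Inr i)) -` A \<inter> space ?PB \<in> sets ?PB"
    using A by (intro measurable_sets[OF measurable_component_singleton]) auto
  have "indep_var ?PA (\<lambda>\<omega>. restrict (\<lambda>j. case_sum G H j \<omega>) ?A)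
      ?PB (\<lambda>\<omega>. restrict (\<lambda>j. case_sum G H j \<omega>) ?B)"
    by (rule indep_var_restrict[OF ind]) (use i in auto)
  from indep_varD[OF this KA HB]
  have *: "\<P>(\<omega> in M. ?K (restrict (\<lambda>j. case_sum G H j \<omega>) ?A) = i \<and> H i \<omega> \<in> A) =
      \<P>(\<omega> in M. ?K (restrict (\<lambda>j. case_sum G H j \<omega>) ?A) = i) * \<P>(\<omega> in M. H i \<omega> \<in> A)"
    by (simp add: vimage_def Int_def conj_commute space_PiM)
  \<comment> \<open>Restriction alters only coordinates outside the block, which the ranking of
    \<open>1, ..., m\<close> never reads.\<close>
  have "?K (restrict (\<lambda>j. case_sum G H j \<omega>) ?A) = kth_largest_index m k (\<lambda>j. G j \<omega>)" for \<omega>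
    by (rule kth_largest_index_order_cong) simp
  with * show ?thesis by simp
qed

section \<open>The limit of the outage probability\<close>

theorem mainTheorem11:
  fixes \<Omega> :: "'w measure" and G H :: "nat \<Rightarrow> 'w \<Rightarrow> real"
    and M k :: nat and t1 t2 \<sigma> a b c x :: real
  assumes "prob_space \<Omega>"
    and "M \<ge> 1"
    and "\<And>i. i \<in> {1..M} \<Longrightarrow> distributed \<Omega> lborel (G i) (exponential_density 1)"
    and "\<And>i. i \<in> {1..M} \<Longrightarrow> distributed \<Omega> lborel (H i) (exponential_density 1)"
    and "prob_space.indep_vars \<Omega> (\<lambda>_. borel) (case_sum G H) ({1..M} <+> {1..M})"
    and "\<sigma>\<^sup>2 > 0" and "0 < t1" and "t1 < 1" and "t2 = 1 - t1"
    and "c > 0" and "a * c - b > 0"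
    and "1 \<le> k" and "k \<le> M" and "x > 0"
  shows "((\<lambda>Pt. outage_EBS \<Omega> G H M k t1 t2 (\<sigma>\<^sup>2) a b c Pt x) \<longlongrightarrow>
           1 - exp (- (\<sigma>\<^sup>2 * c * t2 * x / (t1 * (a * c - b))))) at_top"
proof -
  interpret prob_space \<Omega> by fact
  define E where "E Pt i \<omega> = harvested_energy t1 a b c Pt (G i \<omega>)" for Pt i \<omega>
  define E_lim where "E_lim = t1 * (a - b / c)"
  \<comment> \<open>\<open>N\<close> ranks by gains and is free of the power; \<open>N'\<close>
    ranks by the energies at power \<open>Pt\<close>.\<close>
  define N where "N \<omega> = kth_largest_index M k (\<lambda>i. G i \<omega>)" for \<omega>
  define N' where "N' Pt \<omega> = kth_largest_index M k (\<lambda>i. E Pt i \<omega>)" for Pt \<omega>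
  define X where "X Pt \<omega> = snr t2 (\<sigma>\<^sup>2) (H (N' Pt \<omega>) \<omega>) (E Pt (N' Pt \<omega>) \<omega>)" for Pt \<omega>
  define Y where "Y \<omega> = snr t2 (\<sigma>\<^sup>2) (H (N \<omega>) \<omega>) E_lim" for \<omega>
  define y where "y = \<sigma>\<^sup>2 * c * t2 * x / (t1 * (a * c - b))"

  have t2: "0 < t2" using assms by simp
  \<comment> \<open>Since \<open>a - b / c = (a * c - b) / c\<close>, the limiting SNR is
    \<open>C\<close> times the gain \<open>h\<close>; hence the SNR threshold \<open>x\<close>
    becomes the gain threshold \<open>y = x / C\<close>.\<close>
  define C where "C = t1 * (a * c - b) / (\<sigma>\<^sup>2 * c * t2)"
  have C: "0 < C" unfolding C_def using assms t2 by simp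
  have y_eq: "y = x / C" by (simp add: y_def C_def mult_ac)
  have y: "0 \<le> y" unfolding y_eq using assms C by simp
  have "snr t2 (\<sigma>\<^sup>2) h E_lim = h * C" for h
    using assms(10) by (simp add: snr_def E_lim_def C_def field_simps)
  then have snr_le_iff: "snr t2 (\<sigma>\<^sup>2) h E_lim \<le> x \<longleftrightarrow> h \<le> y"
    and snr_eq_iff: "snr t2 (\<sigma>\<^sup>2) h E_lim = x \<longleftrightarrow> h = y" for h
    using C by (simp_all add: y_eq pos_le_divide_eq eq_divide_eq)

  have G: "G i \<in> borel_measurable \<Omega>" and H: "H i \<in> borel_measurable \<Omega>" if "i \<in> {1..M}" for i
    using assms(3,4)[OF that, THEN distributed_measurable] by simp_all
  have E: "E Pt i \<in> borel_measurable \<Omega>" if "i \<in> {1..M}" for Pt i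
    using G[OF that] unfolding E_def harvested_energy_def by measurable
  have N_in: "N \<omega> \<in> {1..M}" and N'_in: "N' Pt \<omega> \<in> {1..M}" for Pt \<omega>
    unfolding N_def N'_def using assms kth_largest_index_in_range by auto
  \<comment> \<open>The codomain is narrowed to \<open>{1..M}\<close>, where the gains are known to
    be measurable, so that evaluation at the random index is a measurable composition.\<close>
  have N: "N \<in> measurable \<Omega> (count_space {1..M})"
    unfolding N_def
    by (rule measurable_count_space_extend[OF subset_UNIV _ measurable_kth_largest_index])
      (use N_in G in \<open>auto simp: N_def\<close>)
  have N': "N' Pt \<in> measurable \<Omega> (count_space {1..M})" for Pt
    unfolding N'_def
    by (rule measurable_count_space_extend[OF subset_UNIV _ measurable_kth_largest_index])
      (use N'_in E in \<open>auto simp: N'_def\<close>)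
  have X: "X Pt \<in> borel_measurable \<Omega>" for Pt
    unfolding X_def
    by (rule measurable_compose_countable'[OF _ N']) (use E H in \<open>auto simp: snr_def\<close>)
  have Y: "Y \<in> borel_measurable \<Omega>"
    unfolding Y_def
    by (rule measurable_compose_countable'[OF _ N]) (use H in \<open>auto simp: snr_def\<close>)

  \<comment> \<open>Positive gains serve twice: they make the energy order agree with the gain
    order, and they make every energy reach its limit.\<close>
  have "AE \<omega> in \<Omega>. \<forall>i\<in>{1..M}. 0 < G i \<omega>"
    by (intro AE_finite_allI exponential_AE_pos[OF assms(3)]) auto
  then have "AE \<omega> in \<Omega>. ((\<lambda>Pt. X Pt \<omega>) \<longlongrightarrow> Y \<omega>) at_top"
  proof eventually_elim
    case (elim \<omega>)
    have N'_eq: "N' Pt \<omega> = N \<omega>" if "0 < Pt" for Pt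
      unfolding N'_def N_def E_def using elim assms that
      by (intro kth_largest_index_order_cong harvested_energy_le_iff) (auto intro: less_imp_le)
    \<comment> \<open>For positive power the index is frozen at \<open>N \<omega>\<close>, so only
      the energy of one fixed device varies.\<close>
    have "\<forall>\<^sub>F Pt in at_top. snr t2 (\<sigma>\<^sup>2) (H (N \<omega>) \<omega>) (E Pt (N \<omega>) \<omega>) = X Pt \<omega>"
      using eventually_gt_at_top[of "0::real"] by eventually_elim (simp add: X_def N'_eq)
    moreover have "((\<lambda>Pt. snr t2 (\<sigma>\<^sup>2) (H (N \<omega>) \<omega>) (E Pt (N \<omega>) \<omega>)) \<longlongrightarrow> Y \<omega>) at_top"
      unfolding Y_def snr_def E_def E_lim_def
      using elim N_in by (intro tendsto_intros harvested_energy_tendsto) auto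
    ultimately show ?case by (rule Lim_transform_eventually[rotated])
  qed
  \<comment> \<open>All \<open>M\<close> gains avoid \<open>y\<close> simultaneously off a null set,
    hence so does the randomly selected one.\<close>
  moreover have "AE \<omega> in \<Omega>. \<forall>i\<in>{1..M}. H i \<omega> \<noteq> y"
    by (intro AE_finite_allI distributed_lborel_AE_neq[OF assms(4)]) auto
  then have "AE \<omega> in \<Omega>. Y \<omega> \<noteq> x"
    by eventually_elim (use N_in in \<open>auto simp: Y_def snr_eq_iff\<close>)
  ultimately have "((\<lambda>Pt. \<P>(\<omega> in \<Omega>. X Pt \<omega> \<le> x)) \<longlongrightarrow> \<P>(\<omega> in \<Omega>. Y \<omega> \<le> x)) at_top"
    by (intro prob_tendsto_at_top X Y)
  moreover have "\<P>(\<omega> in \<Omega>. X Pt \<omega> \<le> x) = outage_EBS \<Omega> G H M k t1 t2 (\<sigma>\<^sup>2) a b c Pt x" for Pt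
    by (simp add: outage_EBS_def X_def N'_def E_def Let_def)
  moreover have "\<P>(\<omega> in \<Omega>. Y \<omega> \<le> x) = 1 - exp (- y)"
  proof -
    have "\<P>(\<omega> in \<Omega>. Y \<omega> \<le> x) = \<P>(\<omega> in \<Omega>. H (N \<omega>) \<omega> \<le> y)"
      by (simp add: Y_def snr_le_iff)
    also have "\<dots> = 1 - exp (- y)"
    proof (rule prob_independent_selection[OF N])
      fix i assume i: "i \<in> {1..M}"
      show "Measurable.pred \<Omega> (\<lambda>\<omega>. H i \<omega> \<le> y)"
        using H[OF i] by measurable
      show "\<P>(\<omega> in \<Omega>. N \<omega> = i \<and> H i \<omega> \<le> y) = \<P>(\<omega> in \<Omega>. N \<omega> = i) * \<P>(\<omega> in \<Omega>. H i \<omega> \<le> y)"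
        using indep_kth_largest_index[OF assms(5) i, of "{..y}" k] by (simp add: N_def)
      show "\<P>(\<omega> in \<Omega>. H i \<omega> \<le> y) = 1 - exp (- y)"
        using exponential_distributedD_le[OF assms(4)[OF i] y] by simp
    qed simp
    finally show ?thesis .
  qed
  ultimately show ?thesis by (simp add: y_def)
qed

end
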